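(* Let $\varepsilon>0$. Let $W\colon\mathbb{R}^d\to(-\infty,\infty]$ be locally integrable, lower semicontinuous, symmetric ($W(x)=W(-x)$ for all $x$), and of class $C^1$ on $\mathbb{R}^d\setminus\{0\}$. Let $U\colon[0,\infty)\to\mathbb{R}$ be continuous, of class $C^2$ on $(0,\infty)$, convex, with $U(0)=0$, and such that the function $u(r)=r^dU(r^{-d})$, $r\in(0,\infty)$, is nonincreasing. Let $v(r)=-ru'(r)$ for $r\in(0,\infty)$. If $$\limsup_{r\to\infty}\left(\frac12\sup_{z\in B_{2r}\setminus\{0\}}\big(\nabla W(z)\cdot z\big)-\varepsilon\, v(r\omega_d^{1/d})\right)<0$$ or $$\liminf_{r\to0}\left(\frac12\inf_{z\in B_{2r}\setminus\{0\}}\big(\nabla W(z)\cdot z\big)-\varepsilon\, v(r\omega_d^{1/d})\right)>0,$$ then $E_\varepsilon$ is not bounded below in the class of compactly supported bounded functions (that is, compactly supported bounded probability densities on $\mathbb{R}^d$).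
   Context: $B_r$ denotes the open Euclidean ball of radius $r$ centered at the origin of $\mathbb{R}^d$ and $\omega_d$ the volume of the $d$-dimensional unit ball. For a compactly supported bounded probability density $\rho$ on $\mathbb{R}^d$, $$E_\varepsilon(\rho)=\frac12\int_{\mathbb{R}^d}\int_{\mathbb{R}^d}W(x-y)\rho(x)\rho(y)\,dx\,dy+\varepsilon\int_{\mathbb{R}^d}U(\rho(x))\,dx.$$ *)

theory Defs
  imports "HOL-Analysis.Analysis"
begin

text \<open>
  The ambient space \<open>\<real>\<^sup>d\<close> is a type \<open>'a::euclidean_space\<close> with \<open>d = DIM('a)\<close>; the
  interaction potential, with values in \<open>(-\<infinity>, \<infinity>]\<close>, is a function into \<^typ>\<open>ereal\<close>.
\<close>

definition lower_semicontinuous :: "('a::topological_space \<Rightarrow> ereal) \<Rightarrow> bool" where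
  "lower_semicontinuous W \<longleftrightarrow> (\<forall>x. W x \<le> Liminf (at x) W)"

definition locally_integrable :: "('a::euclidean_space \<Rightarrow> ereal) \<Rightarrow> bool" where
  "locally_integrable W \<longleftrightarrow>
     W \<in> borel_measurable lborel \<and>
     (\<forall>K. compact K \<longrightarrow> (\<integral>\<^sup>+x\<in>K. e2ennreal \<bar>W x\<bar> \<partial>lborel) < \<infinity>)"

text \<open>A junk value where \<open>f\<close> is not differentiable.\<close>

definition gradient :: "('a::euclidean_space \<Rightarrow> real) \<Rightarrow> 'a \<Rightarrow> 'a" where
  "gradient f x = (THE D. GDERIV f x :> D)"

definition C1_on :: "'a::euclidean_space set \<Rightarrow> ('a \<Rightarrow> ereal) \<Rightarrow> bool" where
  "C1_on S W \<longleftrightarrow>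
     (\<forall>x\<in>S. \<bar>W x\<bar> \<noteq> \<infinity>) \<and>
     (\<forall>x\<in>S. (\<lambda>y. real_of_ereal (W y)) differentiable (at x)) \<and>
     continuous_on S (gradient (\<lambda>y. real_of_ereal (W y)))"

definition C2_on :: "real set \<Rightarrow> (real \<Rightarrow> real) \<Rightarrow> bool" where
  "C2_on S U \<longleftrightarrow> (\<forall>r\<in>S. U field_differentiable (at r)) \<and> deriv U C1_differentiable_on S"

definition u_of :: "nat \<Rightarrow> (real \<Rightarrow> real) \<Rightarrow> real \<Rightarrow> real" where
  "u_of d U r = r ^ d * U (1 / r ^ d)"

definition v_of :: "nat \<Rightarrow> (real \<Rightarrow> real) \<Rightarrow> real \<Rightarrow> real" where
  "v_of d U r = - r * deriv (u_of d U) r"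

definition unit_ball_volume :: "'a::euclidean_space itself \<Rightarrow> real" where
  "unit_ball_volume _ = measure lborel (ball (0::'a) 1)"

definition cs_bounded_densities :: "('a::euclidean_space \<Rightarrow> real) set" where
  "cs_bounded_densities =
     {\<rho>. has_bochner_integral lborel \<rho> 1 \<and> (\<forall>x. 0 \<le> \<rho> x) \<and>
         bounded (range \<rho>) \<and> compact (closure {x. \<rho> x \<noteq> 0})}"

text \<open>
  For a locally integrable \<open>W\<close> the set \<open>{x. W x = \<infinity>}\<close> is a null set, so replacing \<open>W\<close> by
  its real part does not affect the interaction integral, which converges absolutely for
  bounded \<open>\<rho>\<close> with compact support.
\<close>

definition energy ::
    "real \<Rightarrow> ('a::euclidean_space \<Rightarrow> ereal) \<Rightarrow> (real \<Rightarrow> real) \<Rightarrow> ('a \<Rightarrow> real) \<Rightarrow> real" where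
  "energy \<epsilon> W U \<rho> =
     1/2 * (LINT x|lborel. LINT y|lborel. real_of_ereal (W (x - y)) * \<rho> x * \<rho> y)
     + \<epsilon> * (LINT x|lborel. U (\<rho> x))"

end

(*
  Test the energy on the uniform density of B_r. There it equals
  J(r) / (2 \<omega>^2) + \<epsilon> u(r \<omega>^{1/d}),
  where J(r) integrates W(r(x - y)) over x, y in the unit ball. Since
  (d/dt) W(e^t z) = \<nabla>W(e^t z) . e^t z and (d/dt) u(e^t k) = - v(e^t k), the first (second)
  hypothesis bounds the slope of the energy in the variable t = ln r by a negative constant
  near +\<infinity> (below by a positive constant near -\<infinity>), so the energy tends to -\<infinity>.
  Only increments of J are estimated, which avoids differentiating under the integral sign.
*)
theory Submission
  imports Defs
begin

section \<open>From local increment bounds to a global one\<close>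

text \<open>
  The bound on \<open>P\<close> involves \<open>q\<close> at the right end point, so it is only sharp on short intervals;
  continuity of \<open>q\<close> and bisection make it global.
\<close>
lemma increment_le_of_local_bound:
  fixes P Q q :: "real \<Rightarrow> real"
  assumes "A \<le> B"
    and P: "\<And>s t. A \<le> s \<Longrightarrow> s \<le> t \<Longrightarrow> t \<le> B \<Longrightarrow> P t - P s \<le> (m - q t) * (t - s)"
    and Q: "\<And>t. A \<le> t \<Longrightarrow> t \<le> B \<Longrightarrow> (Q has_real_derivative q t) (at t)"
    and q: "continuous_on {A..B} q"
  shows "(P B + Q B) - (P A + Q A) \<le> m * (B - A)"
proof (rule field_le_epsilon)
  fix e :: real assume "0 < e"
  \<comment> \<open>The \<open>+ 1\<close> keeps the denominator positive when \<open>A = B\<close>,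
    and \<open>e' * (B - A) \<le> e\<close> still holds.\<close>
  define e' where "e' = e / (B - A + 1)"
  have e': "0 < e'" using \<open>0 < e\<close> \<open>A \<le> B\<close> by (simp add: e'_def)
  \<comment> \<open>The estimate with slack \<open>e'\<close> adds up over adjacent intervals, as
    bisection requires. The guard is there because the short intervals around a point may stick out
    of \<open>[A, B]\<close>.\<close>
  define R where "R s t \<longleftrightarrow> (A \<le> s \<and> t \<le> B \<longrightarrow> (P t + Q t) - (P s + Q s) \<le> (m + e') * (t - s))" for s t
  have "R A B"
    using \<open>A \<le> B\<close>
  proof (induct rule: Bolzano)
    case (trans a b c)
    then show ?case by (auto simp: R_def algebra_simps)
  next
    case (local x)
    from q local have "continuous (at x within {A..B}) q"
      by (simp add: continuous_on_eq_continuous_within)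
    then obtain d where d: "d > 0" "\<And>y. y \<in> {A..B} \<Longrightarrow> \<bar>y - x\<bar> < d \<Longrightarrow> \<bar>q y - q x\<bar> < e' / 2"
      using e' unfolding continuous_within_eps_delta dist_real_def by (metis half_gt_zero)
    show ?case
      unfolding R_def
    proof (intro exI[of _ d] conjI allI impI)
      fix a b assume ab: "a \<le> x \<and> x \<le> b \<and> b - a < d" and AB: "A \<le> a \<and> b \<le> B"
      show "(P b + Q b) - (P a + Q a) \<le> (m + e') * (b - a)"
      proof (cases "a = b")
        case False
        with ab have "a < b" by simp
        \<comment> \<open>The increment of \<open>Q\<close> is governed by \<open>q z\<close>, the
          bound on \<open>P\<close> by \<open>q b\<close>. Both points are closer than
          \<open>d\<close> to \<open>x\<close>, so the two values differ by less than
          \<open>e'\<close>.\<close>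
        then obtain z where z: "a < z" "z < b" "Q b - Q a = (b - a) * q z"
          using MVT2[of a b Q q] Q AB by force
        have "\<bar>q z - q x\<bar> < e' / 2" "\<bar>q b - q x\<bar> < e' / 2"
          using z ab AB by (auto simp del: less_divide_eq_numeral1 intro!: d(2))
        then have "q z \<le> q b + e'" by linarith
        then have "(b - a) * q z \<le> (b - a) * (q b + e')"
          using \<open>a < b\<close> by (intro mult_left_mono) auto
        moreover have "P b - P a \<le> (m - q b) * (b - a)"
          using P AB \<open>a < b\<close> by simp
        ultimately show ?thesis using z(3) by (simp add: algebra_simps)
      qed simp
    qed (fact d)
  qed
  then have "(P B + Q B) - (P A + Q A) \<le> m * (B - A) + e' * (B - A)"
    by (simp add: R_def algebra_simps)
  also have "e' * (B - A) \<le> e"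
    using \<open>0 < e\<close> \<open>A \<le> B\<close> by (simp add: e'_def field_simps)
  finally show "(P B + Q B) - (P A + Q A) \<le> m * (B - A) + e" by simp
qed

section \<open>Gradients and increments along rays\<close>

text \<open>\<open>gradient\<close> is a definite description, so existence and uniqueness are both
  due: the linear derivative is an inner product with the vector of its values on the basis, and
  uniqueness of the derivative forces any two such vectors to agree.\<close>

lemma has_derivative_gradient:
  fixes f :: "'a::euclidean_space \<Rightarrow> real"
  assumes "f differentiable (at x)"
  shows "(f has_derivative (\<lambda>h. h \<bullet> gradient f x)) (at x)"
proof -
  obtain f' where f': "(f has_derivative f') (at x)"
    using assms by (auto simp: differentiable_def)
  interpret linear f' using has_derivative_linear[OF f'] .
  define D where "D = (\<Sum>b\<in>Basis. f' b *\<^sub>R b)"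
  have "f' = (\<lambda>h. h \<bullet> D)"
  proof
    fix h
    have "f' h = f' (\<Sum>b\<in>Basis. (h \<bullet> b) *\<^sub>R b)" by (simp add: euclidean_representation)
    also have "\<dots> = (\<Sum>b\<in>Basis. (h \<bullet> b) * f' b)" by (simp add: sum scale)
    also have "\<dots> = h \<bullet> D" by (simp add: D_def inner_sum_right mult.commute)
    finally show "f' h = h \<bullet> D" .
  qed
  then have D: "GDERIV f x :> D" using f' by (simp add: gderiv_def)
  have "gradient f x = D"
    unfolding gradient_def
  proof (rule the_equality)
    show "GDERIV f x :> D" by (rule D)
  next
    fix D' assume "GDERIV f x :> D'"
    then have "(\<lambda>h. h \<bullet> D') = (\<lambda>h. h \<bullet> D)"
      using D unfolding gderiv_def by (rule has_derivative_unique)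
    then show "D' = D" by (metis inner_commute vector_eq_rdot)
  qed
  then show ?thesis using D by (simp add: gderiv_def)
qed

text \<open>Mean value theorem for \<open>t \<mapsto> w (exp t *\<^sub>R z)\<close>, whose
  derivative is \<open>gradient w y \<bullet> y\<close> at \<open>y = exp t *\<^sub>R z\<close>; the
  ray stays away from the origin. With \<open>\<sigma> = -1\<close> a lower bound on the slope takes
  the form of an upper bound.\<close>

lemma radial_increment_le:
  fixes w :: "'a::euclidean_space \<Rightarrow> real"
  assumes diff: "\<And>x. x \<noteq> 0 \<Longrightarrow> w differentiable (at x)"
    and ab: "a \<le> b" and z: "z \<noteq> 0"
    and K: "\<And>t. a \<le> t \<Longrightarrow> t \<le> b \<Longrightarrow>
        \<sigma> * (gradient w (exp t *\<^sub>R z) \<bullet> (exp t *\<^sub>R z)) \<le> K"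
  shows "\<sigma> * (w (exp b *\<^sub>R z) - w (exp a *\<^sub>R z)) \<le> K * (b - a)"
proof (cases "a = b")
  case False
  have *: "((\<lambda>t. w (exp t *\<^sub>R z)) has_real_derivative gradient w (exp t *\<^sub>R z) \<bullet> (exp t *\<^sub>R z)) (at t)" for t
  proof -
    have 1: "((\<lambda>t. exp t *\<^sub>R z) has_derivative (\<lambda>h. (h * exp t) *\<^sub>R z)) (at t)"
      by (auto intro!: derivative_eq_intros)
    have 2: "(\<lambda>h. (h * exp t) *\<^sub>R z \<bullet> D) = (*) (D \<bullet> (exp t *\<^sub>R z))" for D
      by (auto simp: fun_eq_iff inner_commute)
    show ?thesis
      using has_derivative_compose[OF 1 has_derivative_gradient[OF diff]] z
      unfolding has_field_derivative_def 2 by simp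
  qed
  obtain t where "a < t" "t < b" 
    "w (exp b *\<^sub>R z) - w (exp a *\<^sub>R z) = (b - a) * (gradient w (exp t *\<^sub>R z) \<bullet> (exp t *\<^sub>R z))"
    using MVT2[OF _ *, of a b] False ab by force
  then show ?thesis
    using mult_left_mono[OF K[of t], of "b - a"] by (simp add: mult_ac)
qed simp

section \<open>Changes of variables and the interaction on balls\<close>

text \<open>Lebesgue measure is its own image under \<open>x \<mapsto> t + c *\<^sub>R x\<close> up
  to the Jacobian \<open>\<bar>c\<bar> ^ DIM('a)\<close>. Positive \<open>c\<close> rescales balls
  to the unit ball; negative \<open>c\<close> treats \<open>w (r *\<^sub>R (x - y))\<close> as a
  function of \<open>y\<close>.\<close>

lemma
  fixes f :: "'a::euclidean_space \<Rightarrow> real"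
  assumes f: "f \<in> borel_measurable borel" and c: "c \<noteq> 0"
  shows integral_lborel_affine:
      "(LINT x|lborel. f x) = \<bar>c\<bar> ^ DIM('a) * (LINT x|lborel. f (t + c *\<^sub>R x))" (is ?I)
    and integrable_lborel_affine:
      "integrable lborel f \<Longrightarrow> integrable lborel (\<lambda>x. f (t + c *\<^sub>R x))" (is "_ \<Longrightarrow> ?J")
proof -
  have [measurable]: "f \<in> borel_measurable borel" by fact
  let ?D = "distr lborel borel (\<lambda>x. t + c *\<^sub>R x)"
  have eq: "lborel = density ?D (\<lambda>_. ennreal (\<bar>c\<bar> ^ DIM('a)))"
    using lborel_affine[OF c, of t] by (simp add: ennreal_power)
  have "(LINT x|lborel. f x) = (LINT x|density ?D (\<lambda>_. ennreal (\<bar>c\<bar> ^ DIM('a))). f x)"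
    using eq by simp
  also have "\<dots> = \<bar>c\<bar> ^ DIM('a) * (LINT x|lborel. f (t + c *\<^sub>R x))"
    by (subst integral_density) (auto simp: integral_distr)
  finally show ?I .
  assume "integrable lborel f"
  then have "integrable (density ?D (\<lambda>_. ennreal (\<bar>c\<bar> ^ DIM('a)))) f"
    using eq by simp
  then show ?J
    using c by (subst (asm) integrable_density) (auto simp: integrable_distr_eq)
qed

lemma integrable_indicator_ball:
  "integrable lborel (indicator (ball (0::'a::euclidean_space) r) :: 'a \<Rightarrow> real)"
  using emeasure_lborel_ball_finite[of "0::'a" r] by simp

text \<open>With both variables rescaled to the unit ball, \<open>r\<close> enters only through the
  argument of \<open>w\<close>, so integrands for different radii can be compared pointwise.\<close>

definition ball_interaction :: "('a::euclidean_space \<Rightarrow> real) \<Rightarrow> real \<Rightarrow> real" where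
  "ball_interaction w r = (LINT x|lborel. LINT y|lborel.
     w (r *\<^sub>R (x - y)) * indicator (ball 0 1) x * indicator (ball 0 1) y)"

text \<open>For \<open>x\<close> and \<open>y\<close> in the unit ball,
  \<open>r *\<^sub>R (x - y)\<close> has norm at most \<open>2 * r\<close>. Hence \<open>w\<close>
  may be replaced by its truncation to that ball, which is integrable.\<close>

lemma
  fixes w :: "'a::euclidean_space \<Rightarrow> real"
  assumes w[measurable]: "w \<in> borel_measurable borel"
    and int: "\<And>R. integrable lborel (\<lambda>x. w x * indicator (cball 0 R) x)"
    and r: "0 < r"
  shows integrable_ball_interaction_inner:
      "integrable lborel (\<lambda>y. w (r *\<^sub>R (x - y)) * indicator (ball 0 1) x * indicator (ball 0 1) y)"
      (is "integrable _ (?f x)")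
    and integrable_ball_interaction_outer:
      "integrable lborel (\<lambda>x. LINT y|lborel.
         w (r *\<^sub>R (x - y)) * indicator (ball 0 1) x * indicator (ball 0 1) y)"
proof -
  let ?g = "\<lambda>z. w z * indicator (cball 0 (2 * r)) z"
  have g: "integrable lborel (\<lambda>y. ?g (r *\<^sub>R x + (- r) *\<^sub>R y))" for x
    using integrable_lborel_affine[of ?g "- r" "r *\<^sub>R x"] int r by simp
  \<comment> \<open>The indicator in \<open>x\<close> is kept on the right so that the resulting
    bound on the inner integral is itself integrable in \<open>x\<close>.\<close>
  have le: "norm (?f x y) \<le> indicator (ball 0 1) x * \<bar>?g (r *\<^sub>R x + (- r) *\<^sub>R y)\<bar>" for x y
  proof (cases "x \<in> ball 0 1 \<and> y \<in> ball 0 1")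
    case True
    have "norm (r *\<^sub>R x + (- r) *\<^sub>R y) = r * norm (x - y)"
      using r by (simp add: algebra_simps flip: scaleR_diff_right)
    also have "\<dots> \<le> r * 2"
      using True r norm_triangle_ineq4[of x y] by (intro mult_left_mono) auto
    finally show ?thesis using True by (simp add: algebra_simps indicator_def)
  qed (auto simp: indicator_def)
  show inner: "integrable lborel (?f x)" for x
  proof (rule Bochner_Integration.integrable_bound)
    show "integrable lborel (\<lambda>y. indicator (ball 0 1) x * \<bar>?g (r *\<^sub>R x + (- r) *\<^sub>R y)\<bar>)"
      by (intro integrable_mult_right integrable_abs g)
    have [measurable]: "ball (0::'a) 1 \<in> sets borel" by simp
    show "?f x \<in> borel_measurable lborel" by measurable
    show "AE y in lborel. norm (?f x y)
        \<le> norm (indicator (ball 0 1) x * \<bar>?g (r *\<^sub>R x + (- r) *\<^sub>R y)\<bar>)"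
      using order.trans[OF le abs_ge_self] by (intro AE_I2) simp
  qed
  have [measurable]: "ball (0::'a) 1 \<in> sets borel" "cball (0::'a) (2 * r) \<in> sets borel" by simp_all
  \<comment> \<open>The integral over \<open>y\<close> does not depend on \<open>x\<close>, by
    invariance under translation and reflection; \<open>r ^ DIM('a)\<close> is the Jacobian of the
    scaling.\<close>
  define C where "C = (LINT z|lborel. \<bar>?g z\<bar>) / r ^ DIM('a)"
  have C: "(LINT y|lborel. \<bar>?g (r *\<^sub>R x + (- r) *\<^sub>R y)\<bar>) = C" for x
    using integral_lborel_affine[of "\<lambda>z. \<bar>?g z\<bar>" "- r" "r *\<^sub>R x"] r by (simp add: C_def abs_mult)
  have bound: "norm (LINT y|lborel. ?f x y) \<le> indicator (ball 0 1) x * C" for x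
  proof -
    have "norm (LINT y|lborel. ?f x y) \<le> (LINT y|lborel. norm (?f x y))"
      by (rule integral_norm_bound)
    also have "\<dots> \<le> (LINT y|lborel. indicator (ball 0 1) x * \<bar>?g (r *\<^sub>R x + (- r) *\<^sub>R y)\<bar>)"
      using g[of x] inner le by (intro integral_mono) auto
    also have "\<dots> = indicator (ball 0 1) x * C"
      by (subst integral_mult_right_zero) (simp only: C)
    finally show ?thesis .
  qed
  show "integrable lborel (\<lambda>x. LINT y|lborel. ?f x y)"
  proof (rule Bochner_Integration.integrable_bound)
    show "integrable lborel (\<lambda>x. indicator (ball (0::'a) 1) x * C)"
      by (intro integrable_mult_left integrable_indicator_ball)
    show "(\<lambda>x. LINT y|lborel. ?f x y) \<in> borel_measurable lborel"
      by measurable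
    show "AE x in lborel. norm (LINT y|lborel. ?f x y) \<le> norm (indicator (ball (0::'a) 1) x * C)"
    proof (rule AE_I2)
      fix x :: 'a
      show "norm (LINT y|lborel. ?f x y) \<le> norm (indicator (ball (0::'a) 1) x * C)"
        by (rule order.trans[OF bound]) simp
    qed
  qed
qed

text \<open>The pointwise bound \<open>K\<close> is integrated over pairs of points of the unit
  ball, and each variable contributes one factor of the volume. Off these pairs both sides are zero,
  so the sign of \<open>K\<close> does not matter.\<close>

lemma ball_interaction_increment_le:
  fixes w :: "'a::euclidean_space \<Rightarrow> real"
  assumes w[measurable]: "w \<in> borel_measurable borel"
    and int: "\<And>R. integrable lborel (\<lambda>x. w x * indicator (cball 0 R) x)"
    and a: "0 < a" and b: "0 < b"
    and K: "\<And>z. z \<in> ball 0 2 - {0} \<Longrightarrow> \<sigma> * (w (b *\<^sub>R z) - w (a *\<^sub>R z)) \<le> K"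
  shows "\<sigma> * (ball_interaction w b - ball_interaction w a)
    \<le> K * (unit_ball_volume TYPE('a))\<^sup>2"
proof -
  let ?f = "\<lambda>r x y. w (r *\<^sub>R (x - y)) * indicator (ball 0 1) x * indicator (ball 0 1) (y::'a)"
  let ?i = "indicator (ball 0 1) :: 'a \<Rightarrow> real"
  let ?\<omega> = "unit_ball_volume TYPE('a)"
  note I = integrable_ball_interaction_inner[OF w int] integrable_ball_interaction_outer[OF w int]
  have i: "integrable lborel ?i" by (rule integrable_indicator_ball)
  have i\<omega>: "(LINT x|lborel. ?i x) = ?\<omega>"
    by (simp add: unit_ball_volume_def)
  have inner: "\<sigma> * ((LINT y|lborel. ?f b x y) - (LINT y|lborel. ?f a x y)) \<le> K * ?\<omega> * ?i x" for x
  proof -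
    have "\<sigma> * ((LINT y|lborel. ?f b x y) - (LINT y|lborel. ?f a x y))
        = (LINT y|lborel. \<sigma> * (?f b x y - ?f a x y))"
      using I(1)[OF a] I(1)[OF b] by simp
    also have "\<dots> \<le> (LINT y|lborel. K * ?i x * ?i y)"
    proof (rule integral_mono_AE)
      show "integrable lborel (\<lambda>y. \<sigma> * (?f b x y - ?f a x y))"
        using I(1)[OF a] I(1)[OF b] by (intro integrable_mult_right Bochner_Integration.integrable_diff)
      show "integrable lborel (\<lambda>y. K * ?i x * ?i y)"
        using i by (intro integrable_mult_right)
      \<comment> \<open>The bound \<open>K\<close> says nothing at \<open>z = 0\<close>, so the
        diagonal \<open>y = x\<close> is left out; for fixed \<open>x\<close> it is a null set in
        \<open>y\<close>.\<close>
      have *: "\<sigma> * (?f b x y - ?f a x y) \<le> K * ?i x * ?i y" if "y \<noteq> x" for y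
      proof (cases "x \<in> ball 0 1 \<and> y \<in> ball 0 1")
        case True
        then have "x - y \<in> ball 0 2 - {0}"
          using that norm_triangle_ineq4[of x y] by auto
        from K[OF this] show ?thesis using True by simp
      qed (auto simp: indicator_def)
      show "AE y in lborel. \<sigma> * (?f b x y - ?f a x y) \<le> K * ?i x * ?i y"
        using AE_lborel_singleton[of x] by eventually_elim (rule *)
    qed
    also have "\<dots> = K * ?\<omega> * ?i x"
      using i\<omega> by (subst integral_mult_right_zero) simp
    finally show ?thesis .
  qed
  have "\<sigma> * (ball_interaction w b - ball_interaction w a)
      = (LINT x|lborel. \<sigma> * ((LINT y|lborel. ?f b x y) - (LINT y|lborel. ?f a x y)))"
    unfolding ball_interaction_def using I(2)[OF a] I(2)[OF b] by simp
  also have "\<dots> \<le> (LINT x|lborel. K * ?\<omega> * ?i x)"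
    using inner i I(2)[OF a] I(2)[OF b]
    by (intro integral_mono integrable_mult_right Bochner_Integration.integrable_diff) auto
  also have "\<dots> = K * ?\<omega>\<^sup>2"
    using i\<omega> by (subst integral_mult_right_zero) (simp add: power2_eq_square)
  finally show ?thesis .
qed

section \<open>The energy of uniform densities\<close>

definition uniform_density :: "real \<Rightarrow> 'a::euclidean_space \<Rightarrow> real" where
  "uniform_density r x = indicator (ball 0 r) x / measure lborel (ball (0::'a) r)"

lemma uniform_density_mem:
  assumes "0 < r"
  shows "(uniform_density r :: 'a::euclidean_space \<Rightarrow> real) \<in> cs_bounded_densities"
proof -
  let ?V = "measure lborel (ball (0::'a) r)"
  have V: "0 < ?V" using assms by simp
  have "has_bochner_integral lborel (uniform_density r :: 'a \<Rightarrow> real) 1"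
    unfolding has_bochner_integral_iff uniform_density_def
    using V integrable_indicator_ball[of r] by auto
  moreover have "bounded (range (uniform_density r :: 'a \<Rightarrow> real))"
    using V by (intro boundedI[of _ "1 / ?V"]) (auto simp: uniform_density_def indicator_def)
  moreover have "bounded {x. (uniform_density r :: 'a \<Rightarrow> real) x \<noteq> 0}"
    by (rule bounded_subset[OF bounded_ball[of 0 r]]) (auto simp: uniform_density_def indicator_def)
  ultimately show ?thesis
    by (auto simp: cs_bounded_densities_def uniform_density_def compact_closure)
qed

lemma measure_ball_eq:
  assumes "0 \<le> r"
  shows "measure lborel (ball (0::'a::euclidean_space) r) = unit_ball_volume TYPE('a) * r ^ DIM('a)"
  using assms by (simp add: unit_ball_volume_def content_ball)

lemma unit_ball_volume_pos: "0 < unit_ball_volume TYPE('a::euclidean_space)"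
  by (simp add: unit_ball_volume_def)

text \<open>Substituting \<open>x \<mapsto> r *\<^sub>R x\<close> in both variables yields
  \<open>(r ^ DIM('a))\<^sup>2\<close>, which against the squared normalisation leaves
  \<open>1 / \<omega>\<^sup>2\<close>. In the internal energy only the ball contributes, since
  \<open>U 0 = 0\<close>.\<close>

lemma energy_uniform_density:
  fixes W :: "'a::euclidean_space \<Rightarrow> ereal"
  defines "\<omega> \<equiv> unit_ball_volume TYPE('a)" and "w \<equiv> \<lambda>x. real_of_ereal (W x)"
  assumes w[measurable]: "w \<in> borel_measurable borel" and r: "0 < r" and "U 0 = 0"
  shows "energy \<epsilon> W U (uniform_density r)
    = ball_interaction w r / (2 * \<omega>\<^sup>2) + \<epsilon> * u_of DIM('a) U (r * \<omega> powr (1 / DIM('a)))"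
proof -
  let ?V = "measure lborel (ball (0::'a) r)"
  let ?n = "DIM('a)"
  let ?i = "indicator (ball 0 1) :: 'a \<Rightarrow> real"
  have \<omega>: "0 < \<omega>" unfolding \<omega>_def by (rule unit_ball_volume_pos)
  have V: "?V = \<omega> * r ^ ?n" unfolding \<omega>_def using r by (simp add: measure_ball_eq)
  \<comment> \<open>This is why \<open>r\<close> is multiplied by
    \<open>\<omega> powr (1 / DIM('a))\<close>: the power in \<open>u_of\<close> becomes the volume
    of the ball.\<close>
  have pow: "(r * \<omega> powr (1 / ?n)) ^ ?n = ?V"
    using \<omega> by (simp add: V power_mult_distrib powr_powr flip: powr_realpow)
  have "(LINT x|lborel. U (uniform_density r (x::'a))) = (LINT x|lborel. U (1 / ?V) * indicator (ball (0::'a) r) x)"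
    using \<open>U 0 = 0\<close>
    by (intro Bochner_Integration.integral_cong) (auto simp: uniform_density_def indicator_def)
  also have "\<dots> = U (1 / ?V) * ?V"
    by (subst integral_mult_right_zero) simp
  also have "\<dots> = u_of ?n U (r * \<omega> powr (1 / ?n))"
    by (simp add: u_of_def pow)
  finally have internal: "(LINT x|lborel. U (uniform_density r (x::'a))) = \<dots>" .
  have dens: "uniform_density r (r *\<^sub>R x) = ?i x / ?V" for x :: 'a
    using r by (simp add: uniform_density_def indicator_def)
  have [measurable]: "(uniform_density r :: 'a \<Rightarrow> real) \<in> borel_measurable borel"
    unfolding uniform_density_def by (intro borel_measurable_divide borel_measurable_indicator) auto
  let ?F = "\<lambda>x y. w (x - y) * uniform_density r x * uniform_density r (y::'a)"
  have "(LINT x|lborel. LINT y|lborel. ?F x y)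
      = (LINT x|lborel. r ^ ?n * (LINT y|lborel. ?F x (r *\<^sub>R y)))"
    using r by (subst integral_lborel_affine[where t=0 and c=r]) auto
  also have "\<dots> = r ^ ?n * (LINT x|lborel. r ^ ?n * (LINT y|lborel. ?F (r *\<^sub>R x) (r *\<^sub>R y)))"
    using r by (subst integral_lborel_affine[where t=0 and c=r]) auto
  also have "\<dots> = r ^ ?n * (LINT x|lborel. r ^ ?n * (LINT y|lborel.
      (w (r *\<^sub>R (x - y)) * ?i x * ?i y) / ?V\<^sup>2))"
    by (simp add: dens scaleR_diff_right power2_eq_square)
  also have "\<dots> = (r ^ ?n)\<^sup>2 / ?V\<^sup>2 * ball_interaction w r"
    by (simp add: ball_interaction_def power2_eq_square)
  also have "\<dots> = ball_interaction w r / \<omega>\<^sup>2"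
    using r by (simp add: V power_mult_distrib)
  finally show ?thesis
    unfolding energy_def internal by (simp add: w_def)
qed

section \<open>Regularity of \<open>u_of\<close> and \<open>v_of\<close>\<close>

lemma u_of_has_derivative:
  assumes "C2_on {0<..} U" and r: "0 < r"
  shows "(u_of n U has_real_derivative
    (real n * r ^ (n - 1) * U (1 / r ^ n) - real n * deriv U (1 / r ^ n) / r)) (at r)"
proof -
  have U: "(U has_real_derivative deriv U (1 / r ^ n)) (at (1 / r ^ n))"
    using assms unfolding C2_on_def by (auto simp: DERIV_deriv_iff_field_differentiable)
  have "((\<lambda>r. U (1 / r ^ n)) has_real_derivative
      deriv U (1 / r ^ n) * (- (real n * r ^ (n - 1)) / (r ^ n)\<^sup>2)) (at r)"
    by (rule DERIV_chain2[where g = "\<lambda>r. 1 / r ^ n", OF U]) (use r in \<open>auto intro!: derivative_eq_intros simp: power2_eq_square\<close>)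
  from DERIV_mult[OF DERIV_pow[of n r] this]
  have "(u_of n U has_real_derivative
      (real n * r ^ (n - 1) * U (1 / r ^ n)
        + deriv U (1 / r ^ n) * (- (real n * r ^ (n - 1)) / (r ^ n)\<^sup>2) * r ^ n)) (at r)"
    unfolding u_of_def[abs_def] by simp
  \<comment> \<open>For \<open>n = 0\<close> both sides vanish through the factor
    \<open>real n\<close>, whatever the truncated \<open>n - 1\<close> is.\<close>
  moreover have "D * (- (real n * r ^ (n - 1)) / (r ^ n)\<^sup>2) * r ^ n = - (real n * D / r)" for D :: real
    using r by (cases n) (auto simp: field_simps power2_eq_square)
  ultimately show ?thesis
    by simp
qed

text \<open>In the logarithmic variable the chain rule supplies the factor \<open>exp t * k\<close>,
  which is the \<open>r\<close> in \<open>v_of\<close>.\<close>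

lemma u_of_exp_has_derivative:
  assumes U: "C2_on {0<..} U" and k: "0 < k"
  shows "((\<lambda>t. u_of n U (exp t * k)) has_real_derivative - v_of n U (exp t * k)) (at t)"
proof -
  have "0 < exp t * k" using k by simp
  from DERIV_imp_deriv[OF u_of_has_derivative[OF U this]] u_of_has_derivative[OF U this]
  have *: "(u_of n U has_real_derivative deriv (u_of n U) (exp t * k)) (at (exp t * k))"
    by simp
  have "((\<lambda>t. exp t * k) has_real_derivative exp t * k) (at t)"
    by (auto intro!: derivative_eq_intros)
  from DERIV_chain2[OF * this] show ?thesis
    by (simp add: v_of_def mult_ac)
qed

text \<open>On the positive half-line \<open>v_of\<close> equals an explicit expression in
  \<open>U\<close> and \<open>deriv U\<close>, both continuous there. This supplies the continuity
  that \<open>increment_le_of_local_bound\<close> asks for.\<close>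

lemma continuous_on_v_of:
  assumes U: "C2_on {0<..} U"
  shows "continuous_on {0<..} (v_of n U)"
proof -
  have "U differentiable_on {0<..}"
    using U unfolding C2_on_def differentiable_on_def
    by (auto intro: field_differentiable_imp_differentiable differentiable_at_withinI)
  then have c0: "continuous_on {0<..} U" by (rule differentiable_imp_continuous_on)
  have c1: "continuous_on {0<..} (deriv U)"
    using U unfolding C2_on_def by (blast intro: C1_differentiable_imp_continuous_on)
  have "continuous_on {0<..} (\<lambda>r. - r * (real n * r ^ (n - 1) * U (1 / r ^ n) - real n * deriv U (1 / r ^ n) / r))"
    by (intro continuous_intros continuous_on_compose2[OF c0] continuous_on_compose2[OF c1]) auto
  then show ?thesis
    by (rule continuous_on_eq)
      (simp add: v_of_def DERIV_imp_deriv[OF u_of_has_derivative[OF U]])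
qed

text \<open>\<open>real_of_ereal\<close> sends infinite values to 0, so the modulus of the real part
  is dominated everywhere by that of \<open>W\<close>.\<close>

lemma locally_integrable_real:
  fixes W :: "'a::euclidean_space \<Rightarrow> ereal"
  assumes "locally_integrable W"
  shows "(\<lambda>x. real_of_ereal (W x)) \<in> borel_measurable borel"
    and "integrable lborel (\<lambda>x. real_of_ereal (W x) * indicator (cball 0 R) x)"
proof -
  have W[measurable]: "W \<in> borel_measurable borel"
    using assms by (simp add: locally_integrable_def)
  show "(\<lambda>x. real_of_ereal (W x)) \<in> borel_measurable borel" by measurable
  have le: "ennreal \<bar>real_of_ereal x\<bar> \<le> e2ennreal \<bar>x\<bar>" for x
    by (cases x) simp_all
  have "(\<integral>\<^sup>+x. ennreal (norm (real_of_ereal (W x) * indicator (cball 0 R) x)) \<partial>lborel)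
      \<le> (\<integral>\<^sup>+x\<in>cball 0 R. e2ennreal \<bar>W x\<bar> \<partial>lborel)"
    by (intro nn_integral_mono) (auto simp: indicator_def le simp del: abs_real_of_ereal)
  also have "\<dots> < \<infinity>" using assms by (simp add: locally_integrable_def)
  finally show "integrable lborel (\<lambda>x. real_of_ereal (W x) * indicator (cball 0 R) x)"
    by (intro integrableI_bounded borel_measurable_times borel_measurable_indicator) auto
qed

section \<open>Growth of the energy in the logarithm of the radius\<close>

text \<open>The factor \<open>\<sigma>\<close> is used with the values \<open>1\<close> and \<open>-1\<close>, one for each alternative of the theorem.\<close>
lemma energy_uniform_density_growth:
  fixes W :: "'a::euclidean_space \<Rightarrow> ereal"
  defines "\<omega> \<equiv> unit_ball_volume TYPE('a)" and "w \<equiv> \<lambda>x. real_of_ereal (W x)"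
  assumes W: "locally_integrable W" and C1: "C1_on (UNIV - {0}) W"
    and U: "C2_on {0<..} U" "U 0 = 0"
    and a: "0 < a" and ab: "a \<le> b"
    and m: "\<And>r z. a \<le> r \<Longrightarrow> r \<le> b \<Longrightarrow> z \<in> ball 0 (2 * r) - {0} \<Longrightarrow>
        \<sigma> * (1/2 * (gradient w z \<bullet> z) - \<epsilon> * v_of DIM('a) U (r * \<omega> powr (1 / DIM('a)))) \<le> m"
  shows "\<sigma> * (energy \<epsilon> W U (uniform_density b) - energy \<epsilon> W U (uniform_density a))
    \<le> m * (ln b - ln a)"
proof -
  define k where "k = \<omega> powr (1 / DIM('a))"
  define v where "v = v_of DIM('a) U"
  have \<omega>: "0 < \<omega>" unfolding \<omega>_def by (rule unit_ball_volume_pos)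
  then have k: "0 < k" by (simp add: k_def)
  have w: "w \<in> borel_measurable borel" and int: "integrable lborel (\<lambda>x. w x * indicator (cball 0 R) x)" for R
    unfolding w_def using locally_integrable_real[OF W] by auto
  have diff: "w differentiable (at x)" if "x \<noteq> 0" for x
    using C1 that unfolding C1_on_def w_def by simp
  define P where "P t = \<sigma> * ball_interaction w (exp t) / (2 * \<omega>\<^sup>2)" for t
  define Q where "Q t = \<sigma> * \<epsilon> * u_of DIM('a) U (exp t * k)" for t
  have E: "\<sigma> * energy \<epsilon> W U (uniform_density (exp t)) = P t + Q t" for t
    using energy_uniform_density[of W "exp t" U \<epsilon>] w U
    by (simp add: P_def Q_def k_def w_def \<omega>_def algebra_simps)
  have "b > 0" using a ab by simp
  have "(P (ln b) + Q (ln b)) - (P (ln a) + Q (ln a)) \<le> m * (ln b - ln a)"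
  proof (rule increment_le_of_local_bound)
    show "ln a \<le> ln b" using a ab by simp
  next
    fix t
    show "(Q has_real_derivative - (\<sigma> * \<epsilon> * v (exp t * k))) (at t)"
      unfolding Q_def v_def by (rule DERIV_cong[OF DERIV_cmult[OF u_of_exp_has_derivative[OF U(1) k]]]) simp
  next
    show "continuous_on {ln a..ln b} (\<lambda>t. - (\<sigma> * \<epsilon> * v (exp t * k)))"
      unfolding v_def using k
      by (intro continuous_intros continuous_on_compose2[OF continuous_on_v_of[OF U(1)]]) auto
  next
    fix s t assume st: "ln a \<le> s" "s \<le> t" "t \<le> ln b"
    \<comment> \<open>Solving the hypothesis \<open>m\<close> at radius \<open>exp t\<close> for the
      gradient term gives the factor 2. The right end point is chosen because its ball of radius
      \<open>2 * exp t\<close> contains every \<open>exp \<tau> *\<^sub>R z\<close> with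
      \<open>\<tau> \<le> t\<close>.\<close>
    let ?K = "2 * (m + \<sigma> * \<epsilon> * v (exp t * k))"
    have exp_t: "a \<le> exp t" "exp t \<le> b"
      using st a \<open>b > 0\<close> by (metis exp_le_cancel_iff exp_ln order.trans)+
    have "\<sigma> * (w (exp t *\<^sub>R z) - w (exp s *\<^sub>R z)) \<le> ?K * (t - s)" if z: "z \<in> ball 0 2 - {0}" for z
    proof (rule radial_increment_le[OF diff])
      fix \<tau> assume "s \<le> \<tau>" "\<tau> \<le> t"
      have "norm (exp \<tau> *\<^sub>R z) \<le> exp t * norm z"
        using \<open>\<tau> \<le> t\<close> by (simp add: mult_right_mono)
      also have "\<dots> < 2 * exp t" using z by simp
      finally have "exp \<tau> *\<^sub>R z \<in> ball 0 (2 * exp t) - {0}" using z by simp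
      from m[OF exp_t this]
      show "\<sigma> * (gradient w (exp \<tau> *\<^sub>R z) \<bullet> (exp \<tau> *\<^sub>R z)) \<le> ?K"
        unfolding v_def k_def by (simp add: algebra_simps)
    qed (use st z in auto)
    from ball_interaction_increment_le[OF w int _ _ this]
    have "\<sigma> * (ball_interaction w (exp t) - ball_interaction w (exp s)) \<le> ?K * (t - s) * \<omega>\<^sup>2"
      by (simp add: \<omega>_def)
    then have "P t - P s \<le> (?K * (t - s) * \<omega>\<^sup>2) / (2 * \<omega>\<^sup>2)"
      unfolding P_def diff_divide_distrib[symmetric] right_diff_distrib[symmetric]
      by (rule divide_right_mono) simp
    \<comment> \<open>The 2 in \<open>?K\<close> cancels against the factor 1/2 of the interaction
      energy.\<close>
    also have "\<dots> = (m - - (\<sigma> * \<epsilon> * v (exp t * k))) * (t - s)"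
      using \<omega> by (simp add: field_simps)
    finally show "P t - P s \<le> (m - - (\<sigma> * \<epsilon> * v (exp t * k))) * (t - s)" .
  qed
  then show ?thesis
    using E[of "ln a"] E[of "ln b"] a \<open>b > 0\<close> by (simp add: right_diff_distrib)
qed

section \<open>Unboundedness along expanding or shrinking balls\<close>

theorem theorem4p1:
  fixes W :: "'a::euclidean_space \<Rightarrow> ereal"
    and U :: "real \<Rightarrow> real"
    and \<epsilon> :: real
  defines "\<omega> \<equiv> unit_ball_volume TYPE('a)"
    and "gradW \<equiv> gradient (\<lambda>x. real_of_ereal (W x))"
    and "v \<equiv> v_of DIM('a) U"
  assumes "0 < \<epsilon>"
    and "\<And>x. W x \<noteq> -\<infinity>"
    and "locally_integrable W"
    and "lower_semicontinuous W"
    and "\<And>x. W (- x) = W x"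
    and "C1_on (UNIV - {0}) W"
    and "continuous_on {0..} U"
    and "C2_on {0<..} U"
    and "convex_on {0..} U"
    and "U 0 = 0"
    and "antimono_on {0<..} (u_of DIM('a) U)"
    and "Limsup at_top (\<lambda>r. ereal (1/2) * (SUP z\<in>ball 0 (2 * r) - {0}. ereal (gradW z \<bullet> z))
             - ereal (\<epsilon> * v (r * \<omega> powr (1 / DIM('a))))) < 0
       \<or> Liminf (at_right 0) (\<lambda>r. ereal (1/2) * (INF z\<in>ball 0 (2 * r) - {0}. ereal (gradW z \<bullet> z))
             - ereal (\<epsilon> * v (r * \<omega> powr (1 / DIM('a))))) > 0"
  shows "\<not> bdd_below (energy \<epsilon> W U ` cs_bounded_densities)"
proof -
  define k where "k = \<omega> powr (1 / DIM('a))"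
  define E where "E r = energy \<epsilon> W U (uniform_density r)" for r
  have growth: "\<sigma> * (E b - E a) \<le> m * (ln b - ln a)"
    if "0 < a" "a \<le> b"
      and "\<And>r z. a \<le> r \<Longrightarrow> r \<le> b \<Longrightarrow> z \<in> ball 0 (2 * r) - {0} \<Longrightarrow>
        \<sigma> * (1/2 * (gradW z \<bullet> z) - \<epsilon> * v (r * k)) \<le> m" for \<sigma> a b m
    using energy_uniform_density_growth[OF assms(6,9,11,13) that(1,2), of \<sigma> \<epsilon> m] that(3)
    unfolding E_def k_def v_def gradW_def \<omega>_def by blast
  have unbounded: ?thesis if E: "\<And>B. \<exists>r>0. E r < B"
  proof
    assume "bdd_below (energy \<epsilon> W U ` cs_bounded_densities)"
    then obtain B where B: "\<And>\<rho>. \<rho> \<in> cs_bounded_densities \<Longrightarrow> B \<le> energy \<epsilon> W U \<rho>"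
      by (auto simp: bdd_below_def)
    obtain r where "0 < r" "E r < B" using E by blast
    with B[OF uniform_density_mem] show False by (simp add: E_def not_le[symmetric])
  qed
  from assms(15) show ?thesis
  proof
    assume "Limsup at_top (\<lambda>r. ereal (1/2) * (SUP z\<in>ball 0 (2 * r) - {0}. ereal (gradW z \<bullet> z))
             - ereal (\<epsilon> * v (r * \<omega> powr (1 / DIM('a))))) < 0"
    \<comment> \<open>The strict inequality leaves room for a real \<open>m\<close> between the
      upper limit and 0; it bounds the slope of the energy in \<open>ln r\<close> for all large
      radii.\<close>
    from ereal_dense2[OF this] obtain m where m: "Limsup at_top (\<lambda>r. ereal (1/2) * (SUP z\<in>ball 0 (2 * r) - {0}. ereal (gradW z \<bullet> z))
             - ereal (\<epsilon> * v (r * k))) < ereal m" and "ereal m < 0"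
      unfolding k_def by blast
    then have "m < 0" by simp
    from Limsup_lessD[OF m] obtain R0 where R0:
      "\<And>r. R0 \<le> r \<Longrightarrow> ereal (1/2) * (SUP z\<in>ball 0 (2 * r) - {0}. ereal (gradW z \<bullet> z))
             - ereal (\<epsilon> * v (r * k)) < ereal m"
      by (auto simp: eventually_at_top_linorder)
    \<comment> \<open>The maximum with 1 makes \<open>R\<close> positive, so that
      \<open>ln R\<close> is meaningful.\<close>
    define R where "R = max R0 1"
    have bound: "1/2 * (gradW z \<bullet> z) - \<epsilon> * v (r * k) \<le> m" if "R \<le> r" "z \<in> ball 0 (2 * r) - {0}" for r z
    proof -
      have "ereal (1/2) * ereal (gradW z \<bullet> z) - ereal (\<epsilon> * v (r * k))
          \<le> ereal (1/2) * (SUP z\<in>ball 0 (2 * r) - {0}. ereal (gradW z \<bullet> z)) - ereal (\<epsilon> * v (r * k))"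
        using that by (intro ereal_minus_mono ereal_mult_left_mono SUP_upper) auto
      also have "\<dots> < ereal m" using that by (intro R0) (simp add: R_def)
      finally show ?thesis by simp
    qed
    show ?thesis
    proof (rule unbounded)
      fix B
      \<comment> \<open>Chosen so that \<open>m * (ln b - ln R) \<le> B - 1 - E R\<close>; the
        \<open>+ 1\<close> makes the final inequality strict, and \<open>max 0\<close> ensures
        \<open>R \<le> b\<close>.\<close>
      define b where "b = R * exp (max 0 ((E R - B + 1) / - m))"
      have "0 < R" by (simp add: R_def)
      then have "R \<le> b" by (simp add: b_def)
      then have "E b - E R \<le> m * (ln b - ln R)"
        using growth[of R b 1 m] bound \<open>0 < R\<close> by simp
      also have "ln b - ln R = max 0 ((E R - B + 1) / - m)"
        using \<open>0 < R\<close> by (simp add: b_def ln_mult)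
      also have "m * \<dots> \<le> m * ((E R - B + 1) / - m)"
        using \<open>m < 0\<close> by (intro mult_left_mono_neg) auto
      also have "\<dots> = B - 1 - E R" using \<open>m < 0\<close> by (simp add: field_simps)
      finally show "\<exists>r>0. E r < B" using \<open>R \<le> b\<close> \<open>0 < R\<close> by (intro exI[of _ b]) simp
    qed
  next
    assume "Liminf (at_right 0) (\<lambda>r. ereal (1/2) * (INF z\<in>ball 0 (2 * r) - {0}. ereal (gradW z \<bullet> z))
             - ereal (\<epsilon> * v (r * \<omega> powr (1 / DIM('a))))) > 0"
    from ereal_dense2[OF this] obtain m where "0 < ereal m" and m: "ereal m < Liminf (at_right 0)
        (\<lambda>r. ereal (1/2) * (INF z\<in>ball 0 (2 * r) - {0}. ereal (gradW z \<bullet> z)) - ereal (\<epsilon> * v (r * k)))"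
      unfolding k_def by blast
    then have "m > 0" by simp
    from less_LiminfD[OF m] obtain R0 where "0 < R0" and R0:
      "\<And>r. 0 < r \<Longrightarrow> r < R0 \<Longrightarrow> ereal m < ereal (1/2) * (INF z\<in>ball 0 (2 * r) - {0}. ereal (gradW z \<bullet> z))
             - ereal (\<epsilon> * v (r * k))"
      by (auto simp: eventually_at_right_field)
    \<comment> \<open>Halving gives a closed range \<open>r \<le> R\<close> inside the open range
      \<open>r < R0\<close> where the estimate holds.\<close>
    define R where "R = R0 / 2"
    have bound: "m \<le> 1/2 * (gradW z \<bullet> z) - \<epsilon> * v (r * k)" if "0 < r" "r \<le> R" "z \<in> ball 0 (2 * r) - {0}" for r z
    proof -
      have "ereal m < ereal (1/2) * (INF z\<in>ball 0 (2 * r) - {0}. ereal (gradW z \<bullet> z)) - ereal (\<epsilon> * v (r * k))"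
        using that \<open>0 < R0\<close> by (intro R0) (auto simp: R_def)
      also have "\<dots> \<le> ereal (1/2) * ereal (gradW z \<bullet> z) - ereal (\<epsilon> * v (r * k))"
        using that by (intro ereal_minus_mono ereal_mult_left_mono INF_lower) auto
      finally show ?thesis by simp
    qed
    show ?thesis
    proof (rule unbounded)
      fix B
      \<comment> \<open>The mirror image of the previous choice: the radius shrinks until the energy
        has dropped below \<open>B\<close>.\<close>
      define a where "a = R * exp (- max 0 ((E R - B + 1) / m))"
      have "0 < R" using \<open>0 < R0\<close> by (simp add: R_def)
      then have "0 < a" "a \<le> R" by (simp_all add: a_def)
      \<comment> \<open>Here \<open>\<sigma> = -1\<close>: the lower bound \<open>m\<close> on the
        slope is passed to \<open>growth\<close> as the upper bound \<open>- m\<close>.\<close>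
      have "(- 1) * (E R - E a) \<le> (- m) * (ln R - ln a)"
      proof (rule growth)
        fix r and z :: 'a assume "a \<le> r" "r \<le> R" and z: "z \<in> ball 0 (2 * r) - {0}"
        with bound[of r z] \<open>0 < a\<close>
        show "(- 1) * (1/2 * (gradW z \<bullet> z) - \<epsilon> * v (r * k)) \<le> - m" by simp
      qed fact+
      also have "ln R - ln a = max 0 ((E R - B + 1) / m)"
        using \<open>0 < R\<close> by (simp add: a_def ln_mult)
      also have "(- m) * \<dots> \<le> (- m) * ((E R - B + 1) / m)"
        using \<open>m > 0\<close> by (intro mult_left_mono_neg) auto
      also have "\<dots> = B - 1 - E R" using \<open>m > 0\<close> by (simp add: field_simps)
      finally show "\<exists>r>0. E r < B" using \<open>0 < a\<close> by (intro exI[of _ a]) simp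
    qed
  qed
qed

end
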